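(* For every integer $n\ge 0$ and every $x\in D_n$ with $\lambda_n(x)\ne0$ and $B_n(x)\neq 0$, the $n$-th approximant $C_n(x)=A_n(x)/B_n(x)$ of the continued fraction $$\cfrac{q_0(x)}{p_0(x)+\cfrac{q_1(x)}{p_1(x)+\cfrac{q_2(x)}{p_2(x)+\cdots}}}$$ coincides with the $n$-th term of the asymptotic iteration method sequence: $$C_n(x)=\alpha_n(x):=\frac{s_n(x)}{\lambda_n(x)}.$$
   Context: Let $I\subseteq\mathbb{R}$ be an interval and $\lambda_0,s_0\in C^\infty(I)$ (real- or complex-valued), with $\lambda_0(x)\neq 0$ for all $x\in I$; these are the coefficients of the ODE $y''=\lambda_0 y'+s_0 y$. Functions $\lambda_n,s_n\in C^\infty(I)$, for $n\ge1$: $\lambda_n=\lambda_{n-1}'+\lambda_0\lambda_{n-1}+s_{n-1}$ and $s_n=s_{n-1}'+s_0\lambda_{n-1}$. Functions $p_n,q_n$: $p_0=\lambda_0$, $q_0=s_0$ on $D_0=I$, and for $n\ge1$ $$p_n=p_{n-1}+\frac{q_{n-1}'}{q_{n-1}},\qquad q_n=q_{n-1}+p_{n-1}'-p_{n-1}\frac{q_{n-1}'}{q_{n-1}}$$ on the relatively open set $D_n=\{x\in D_{n-1}: q_{n-1}(x)\ne0\}$. Partial numerators and denominators: $A_n=p_nA_{n-1}+q_nA_{n-2}$, $A_{-1}=0$, $A_{-2}=1$, and $B_n=p_nB_{n-1}+q_nB_{n-2}$, $B_{-1}=1$, $B_{-2}=0$, for $n\ge 0$ (on $D_n$). *)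

theory Defs
  imports "HOL-Analysis.Analysis"
begin

text \<open>
  All derivatives are taken relative to a set \<open>I\<close>, so that they are one-sided at those endpoints
  of an interval \<open>I\<close> which belong to it.  The value type is a \<open>real_normed_field\<close>, which covers
  both real-valued and complex-valued functions of a real variable.
\<close>

primrec iterated_derivative_within ::
    "real set \<Rightarrow> (real \<Rightarrow> 'a::real_normed_field) \<Rightarrow> nat \<Rightarrow> real \<Rightarrow> 'a" where
  "iterated_derivative_within I f 0 = f"
| "iterated_derivative_within I f (Suc n) =
     (\<lambda>x. vector_derivative (iterated_derivative_within I f n) (at x within I))"

definition C_infinity_on :: "real set \<Rightarrow> (real \<Rightarrow> 'a::real_normed_field) \<Rightarrow> bool" where
  "C_infinity_on I f \<longleftrightarrow> (\<forall>n. iterated_derivative_within I f n differentiable_on I)"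

fun aim_lambda :: "real set \<Rightarrow> (real \<Rightarrow> 'a::real_normed_field) \<Rightarrow> (real \<Rightarrow> 'a) \<Rightarrow> nat \<Rightarrow> real \<Rightarrow> 'a"
  and aim_s :: "real set \<Rightarrow> (real \<Rightarrow> 'a) \<Rightarrow> (real \<Rightarrow> 'a) \<Rightarrow> nat \<Rightarrow> real \<Rightarrow> 'a" where
  "aim_lambda I lam0 s0 0 = lam0"
| "aim_lambda I lam0 s0 (Suc n) =
     (\<lambda>x. vector_derivative (aim_lambda I lam0 s0 n) (at x within I)
          + lam0 x * aim_lambda I lam0 s0 n x + aim_s I lam0 s0 n x)"
| "aim_s I lam0 s0 0 = s0"
| "aim_s I lam0 s0 (Suc n) =
     (\<lambda>x. vector_derivative (aim_s I lam0 s0 n) (at x within I)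
          + s0 x * aim_lambda I lam0 s0 n x)"

definition aim_alpha :: "real set \<Rightarrow> (real \<Rightarrow> 'a::real_normed_field) \<Rightarrow> (real \<Rightarrow> 'a) \<Rightarrow> nat \<Rightarrow> real \<Rightarrow> 'a"
  where "aim_alpha I lam0 s0 n x = aim_s I lam0 s0 n x / aim_lambda I lam0 s0 n x"

text \<open>
  The functions \<open>p\<^sub>n\<close>, \<open>q\<^sub>n\<close> are meaningful on \<open>D\<^sub>n\<close> only.  Elsewhere they carry arbitrary values,
  which do not influence later stages on \<open>D\<^sub>n\<close>, because the derivatives are taken within \<open>D\<^sub>n\<close>.
\<close>

fun cf_dom :: "real set \<Rightarrow> (real \<Rightarrow> 'a::real_normed_field) \<Rightarrow> (real \<Rightarrow> 'a) \<Rightarrow> nat \<Rightarrow> real set"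
  and cf_p :: "real set \<Rightarrow> (real \<Rightarrow> 'a) \<Rightarrow> (real \<Rightarrow> 'a) \<Rightarrow> nat \<Rightarrow> real \<Rightarrow> 'a"
  and cf_q :: "real set \<Rightarrow> (real \<Rightarrow> 'a) \<Rightarrow> (real \<Rightarrow> 'a) \<Rightarrow> nat \<Rightarrow> real \<Rightarrow> 'a" where
  "cf_dom I lam0 s0 0 = I"
| "cf_dom I lam0 s0 (Suc n) = {x \<in> cf_dom I lam0 s0 n. cf_q I lam0 s0 n x \<noteq> 0}"
| "cf_p I lam0 s0 0 = lam0"
| "cf_p I lam0 s0 (Suc n) =
     (\<lambda>x. cf_p I lam0 s0 n x
          + vector_derivative (cf_q I lam0 s0 n) (at x within cf_dom I lam0 s0 n)
            / cf_q I lam0 s0 n x)"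
| "cf_q I lam0 s0 0 = s0"
| "cf_q I lam0 s0 (Suc n) =
     (\<lambda>x. cf_q I lam0 s0 n x
          + vector_derivative (cf_p I lam0 s0 n) (at x within cf_dom I lam0 s0 n)
          - cf_p I lam0 s0 n x
            * (vector_derivative (cf_q I lam0 s0 n) (at x within cf_dom I lam0 s0 n)
               / cf_q I lam0 s0 n x))"

text \<open>
  Partial numerators and denominators of the continued fraction
  \<open>q 0 / (p 0 + q 1 / (p 1 + \<dots>))\<close>.  The index is shifted by two:
  \<open>A\<^sub>n\<close> is \<open>cf_num p q (n + 2)\<close> and \<open>B\<^sub>n\<close> is \<open>cf_den p q (n + 2)\<close>, for every \<open>n \<ge> -2\<close>.
\<close>

fun cf_num :: "(nat \<Rightarrow> 'a::field) \<Rightarrow> (nat \<Rightarrow> 'a) \<Rightarrow> nat \<Rightarrow> 'a" where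
  "cf_num p q 0 = 1"
| "cf_num p q (Suc 0) = 0"
| "cf_num p q (Suc (Suc n)) = p n * cf_num p q (Suc n) + q n * cf_num p q n"

fun cf_den :: "(nat \<Rightarrow> 'a::field) \<Rightarrow> (nat \<Rightarrow> 'a) \<Rightarrow> nat \<Rightarrow> 'a" where
  "cf_den p q 0 = 0"
| "cf_den p q (Suc 0) = 1"
| "cf_den p q (Suc (Suc n)) = p n * cf_den p q (Suc n) + q n * cf_den p q n"

definition cf_A :: "real set \<Rightarrow> (real \<Rightarrow> 'a::real_normed_field) \<Rightarrow> (real \<Rightarrow> 'a) \<Rightarrow> nat \<Rightarrow> real \<Rightarrow> 'a"
  where "cf_A I lam0 s0 n x = cf_num (\<lambda>k. cf_p I lam0 s0 k x) (\<lambda>k. cf_q I lam0 s0 k x) (n + 2)"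

definition cf_B :: "real set \<Rightarrow> (real \<Rightarrow> 'a::real_normed_field) \<Rightarrow> (real \<Rightarrow> 'a) \<Rightarrow> nat \<Rightarrow> real \<Rightarrow> 'a"
  where "cf_B I lam0 s0 n x = cf_den (\<lambda>k. cf_p I lam0 s0 k x) (\<lambda>k. cf_q I lam0 s0 k x) (n + 2)"

definition cf_approximant ::
    "real set \<Rightarrow> (real \<Rightarrow> 'a::real_normed_field) \<Rightarrow> (real \<Rightarrow> 'a) \<Rightarrow> nat \<Rightarrow> real \<Rightarrow> 'a"
  where "cf_approximant I lam0 s0 n x = cf_A I lam0 s0 n x / cf_B I lam0 s0 n x"

end

theory Submission
  imports Defs
begin

text \<open>
  The iteration maps a pair \<open>(a, b)\<close>, read as \<open>a y' + b y\<close>, to its derivative modulo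
  \<open>y'' = \<lambda>\<^sub>0 y' + s\<^sub>0 y\<close>, so that \<open>\<lambda>\<^sub>n y' + s\<^sub>n y\<close> is the derivative of \<open>y\<close> of order \<open>n + 2\<close>.
  The functions \<open>p\<^sub>n\<close>, \<open>q\<^sub>n\<close> are the coefficients that express this derivative through the two
  preceding ones: differentiating \<open>y'' = p y' + q y\<close> and eliminating \<open>y = (y'' - p y') / q\<close> gives
  \<open>y''' = (p + q'/q) y'' + (q + p' - p q'/q) y'\<close>.  Hence \<open>s\<^sub>n\<close> and \<open>\<lambda>\<^sub>n\<close> satisfy the recurrences of
  \<open>A\<^sub>n\<close> and \<open>B\<^sub>n\<close>, with the same initial values, and in fact \<open>A\<^sub>n = s\<^sub>n\<close> and \<open>B\<^sub>n = \<lambda>\<^sub>n\<close> on \<open>D\<^sub>n\<close>.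
\<close>

section \<open>Repeated differentiability within a set\<close>

text \<open>
  The derivative is existentially quantified, so that restriction to subsets and closure under
  the field operations need no uniqueness of derivatives within the set.
\<close>

primrec times_differentiable_on :: "nat \<Rightarrow> real set \<Rightarrow> (real \<Rightarrow> 'a::real_normed_field) \<Rightarrow> bool" where
  "times_differentiable_on 0 S f \<longleftrightarrow> True"
| "times_differentiable_on (Suc k) S f \<longleftrightarrow>
     (\<exists>f'. (\<forall>x\<in>S. (f has_vector_derivative f' x) (at x within S)) \<and> times_differentiable_on k S f')"

definition smooth_within :: "real set \<Rightarrow> (real \<Rightarrow> 'a::real_normed_field) \<Rightarrow> bool" where
  "smooth_within S f \<longleftrightarrow> (\<forall>k. times_differentiable_on k S f)"

section \<open>Closure under restriction and field operations\<close>

lemma times_differentiable_on_SucD: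
  "times_differentiable_on (Suc k) S f \<Longrightarrow> times_differentiable_on k S f"
proof (induction k arbitrary: f)
  case (Suc k)
  from Suc.prems obtain f' where "\<forall>x\<in>S. (f has_vector_derivative f' x) (at x within S)"
    and "times_differentiable_on (Suc k) S f'"
    by (auto simp only: times_differentiable_on.simps(2)[of "Suc k"])
  with Suc.IH show ?case by auto
qed simp

lemma times_differentiable_on_cong:
  assumes "times_differentiable_on k S f" and "\<And>x. x \<in> S \<Longrightarrow> f x = g x"
  shows "times_differentiable_on k S g"
proof (cases k)
  case (Suc j)
  with assms(1) obtain f' where f': "\<forall>x\<in>S. (f has_vector_derivative f' x) (at x within S)"
    and "times_differentiable_on j S f'"
    by auto
  moreover have "\<forall>x\<in>S. (g has_vector_derivative f' x) (at x within S)"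
    using f' assms(2) by (metis has_vector_derivative_transform)
  ultimately show ?thesis using Suc by auto
qed simp

lemma times_differentiable_on_subset:
  "times_differentiable_on k S f \<Longrightarrow> T \<subseteq> S \<Longrightarrow> times_differentiable_on k T f"
proof (induction k arbitrary: f)
  case (Suc k)
  from Suc.prems(1) obtain f' where "\<forall>x\<in>S. (f has_vector_derivative f' x) (at x within S)"
    and "times_differentiable_on k S f'"
    by auto
  moreover from this(1) have "\<forall>x\<in>T. (f has_vector_derivative f' x) (at x within T)"
    using Suc.prems(2) has_vector_derivative_within_subset by blast
  ultimately show ?case
    using Suc.IH[OF _ Suc.prems(2)] by auto
qed simp

lemma times_differentiable_on_const: "times_differentiable_on k S (\<lambda>_. c)"
proof (induction k arbitrary: c)
  case (Suc k)
  then show ?case by (auto intro!: exI[of _ "\<lambda>_. 0"])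
qed simp

lemma times_differentiable_on_add:
  "times_differentiable_on k S f \<Longrightarrow> times_differentiable_on k S g \<Longrightarrow>
   times_differentiable_on k S (\<lambda>x. f x + g x)"
proof (induction k arbitrary: f g)
  case (Suc k)
  then obtain f' g' where "\<forall>x\<in>S. (f has_vector_derivative f' x) (at x within S)"
    "\<forall>x\<in>S. (g has_vector_derivative g' x) (at x within S)"
    "times_differentiable_on k S f'" "times_differentiable_on k S g'"
    by auto
  with Suc.IH show ?case
    by (auto intro!: exI[of _ "\<lambda>x. f' x + g' x"] has_vector_derivative_add)
qed simp

lemma times_differentiable_on_mult:
  "times_differentiable_on k S f \<Longrightarrow> times_differentiable_on k S g \<Longrightarrow>
   times_differentiable_on k S (\<lambda>x. f x * g x)"
proof (induction k arbitrary: f g)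
  case (Suc k)
  then obtain f' g' where f': "\<forall>x\<in>S. (f has_vector_derivative f' x) (at x within S)"
      "times_differentiable_on k S f'"
    and g': "\<forall>x\<in>S. (g has_vector_derivative g' x) (at x within S)"
      "times_differentiable_on k S g'"
    by auto
  \<comment> \<open>The product rule involves \<open>f\<close> and \<open>g\<close>
    undifferentiated, so both must be brought down to order \<open>k\<close>.\<close>
  have "times_differentiable_on k S f" "times_differentiable_on k S g"
    using Suc.prems[THEN times_differentiable_on_SucD] .
  then have "times_differentiable_on k S (\<lambda>x. f x * g' x + f' x * g x)"
    using f'(2) g'(2) by (intro times_differentiable_on_add Suc.IH)
  moreover have "\<forall>x\<in>S. ((\<lambda>x. f x * g x) has_vector_derivative f x * g' x + f' x * g x) (at x within S)"
    using f'(1) g'(1) by (blast intro: has_vector_derivative_mult)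
  ultimately show ?case by auto
qed simp

text \<open>The derivative is a product of \<open>f'\<close> and two copies of
  \<open>inverse f\<close>, which the induction hypothesis makes \<open>k\<close> times
  differentiable.\<close>

lemma times_differentiable_on_inverse:
  "times_differentiable_on k S f \<Longrightarrow> (\<And>x. x \<in> S \<Longrightarrow> f x \<noteq> 0) \<Longrightarrow>
   times_differentiable_on k S (\<lambda>x. inverse (f x))"
proof (induction k)
  case (Suc k)
  then obtain f' where f': "\<forall>x\<in>S. (f has_vector_derivative f' x) (at x within S)"
    "times_differentiable_on k S f'"
    by auto
  let ?g = "\<lambda>x. (- 1) * (f' x * (inverse (f x) * inverse (f x)))"
  have "((\<lambda>x. inverse (f x)) has_vector_derivative ?g x) (at x within S)" if "x \<in> S" for x
  proof -
    have "(inverse has_field_derivative - (inverse (f x) ^ Suc (Suc 0))) (at (f x) within f ` S)"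
      using Suc.prems(2)[OF that] by (rule DERIV_inverse)
    from field_vector_diff_chain_within[OF _ this] f' that show ?thesis
      by (fastforce simp: o_def)
  qed
  moreover have "times_differentiable_on k S ?g"
    using Suc.IH[OF times_differentiable_on_SucD[OF Suc.prems(1)] Suc.prems(2)] f'(2)
    by (intro times_differentiable_on_mult times_differentiable_on_const)
  ultimately show ?case
    by (simp only: times_differentiable_on.simps(2)) (intro exI[of _ ?g] conjI ballI)
qed simp

lemma smooth_within_arith:
  assumes "smooth_within S f" and "smooth_within S g"
  shows smooth_within_add: "smooth_within S (\<lambda>x. f x + g x)"
    and smooth_within_mult: "smooth_within S (\<lambda>x. f x * g x)"
    and smooth_within_diff: "smooth_within S (\<lambda>x. f x - g x)"
proof -
  show "smooth_within S (\<lambda>x. f x + g x)" and "smooth_within S (\<lambda>x. f x * g x)"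
    using assms
    by (auto simp: smooth_within_def times_differentiable_on_add times_differentiable_on_mult)
  have "times_differentiable_on k S (\<lambda>x. f x + (- 1) * g x)" for k
    using assms unfolding smooth_within_def
    by (intro times_differentiable_on_add times_differentiable_on_mult
        times_differentiable_on_const) auto
  then show "smooth_within S (\<lambda>x. f x - g x)"
    by (simp add: smooth_within_def)
qed

lemma smooth_within_divide:
  assumes "smooth_within S f" and "smooth_within S g" and "\<And>x. x \<in> S \<Longrightarrow> g x \<noteq> 0"
  shows "smooth_within S (\<lambda>x. f x / g x)"
  using assms
  by (simp add: smooth_within_def divide_inverse times_differentiable_on_mult
      times_differentiable_on_inverse)

lemma smooth_within_const: "smooth_within S (\<lambda>_. c)"
  by (simp add: smooth_within_def times_differentiable_on_const)

lemma smooth_within_subset: "smooth_within S f \<Longrightarrow> T \<subseteq> S \<Longrightarrow> smooth_within T f"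
  by (auto simp: smooth_within_def intro: times_differentiable_on_subset)

section \<open>Derivatives of smooth functions\<close>

lemma smooth_within_has_vector_derivative:
  assumes "smooth_within S f" and "x \<in> S"
  shows "(f has_vector_derivative vector_derivative f (at x within S)) (at x within S)"
proof -
  from assms(1) have "times_differentiable_on (Suc 0) S f"
    unfolding smooth_within_def by blast
  with assms(2) show ?thesis
    by (auto intro: differentiableI_vector simp flip: vector_derivative_works)
qed

lemma smooth_within_continuous_on: "smooth_within S f \<Longrightarrow> continuous_on S f"
  by (meson continuous_on_eq_continuous_within has_vector_derivative_continuous
      smooth_within_has_vector_derivative)

text \<open>On a non-trivial filter derivatives are unique, so any existential witness agrees on
  \<open>S\<close> with \<open>vector_derivative\<close>.\<close>

lemma smooth_within_vector_derivative:
  assumes "smooth_within S f" and "\<And>x. x \<in> S \<Longrightarrow> at x within S \<noteq> bot"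
  shows "smooth_within S (\<lambda>x. vector_derivative f (at x within S))"
  unfolding smooth_within_def
proof
  fix k
  from assms(1) have "times_differentiable_on (Suc k) S f"
    unfolding smooth_within_def by blast
  then obtain f' where f': "\<forall>x\<in>S. (f has_vector_derivative f' x) (at x within S)"
    and "times_differentiable_on k S f'"
    by auto
  then show "times_differentiable_on k S (\<lambda>x. vector_derivative f (at x within S))"
    by (elim times_differentiable_on_cong)
       (use assms(2) in \<open>auto intro: vector_derivative_within[symmetric]\<close>)
qed

lemma C_infinity_on_imp_smooth_within:
  assumes "C_infinity_on S f"
  shows "smooth_within S f"
proof -
  \<comment> \<open>The order \<open>n\<close> is kept general, since the witness for the derivative
    is the iterate of order \<open>Suc n\<close>.\<close>
  have "times_differentiable_on k S (iterated_derivative_within S f n)" for k n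
  proof (induction k arbitrary: n)
    case (Suc k)
    have "\<forall>x\<in>S. (iterated_derivative_within S f n has_vector_derivative
        iterated_derivative_within S f (Suc n) x) (at x within S)"
      using assms
      by (auto simp: C_infinity_on_def differentiable_on_def simp flip: vector_derivative_works)
    with Suc show ?case by (metis times_differentiable_on.simps(2))
  qed simp
  from this[of _ 0] show ?thesis by (simp add: smooth_within_def)
qed

section \<open>The two iterations\<close>

text \<open>A non-empty interior excludes a one-point interval, where derivatives within
  \<open>I\<close> would not be unique; a connected set with more than one point has no isolated
  points.\<close>

lemma at_within_interval_neq_bot:
  fixes I :: "real set"
  assumes "is_interval I" and "interior I \<noteq> {}" and "x \<in> I"
  shows "at x within I \<noteq> bot"
proof -
  have "x islimpt I"
    using assms
    by (metis connected_imp_perfect interior_empty interior_singleton is_interval_connected)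
  then show ?thesis by (simp add: trivial_limit_within)
qed

text \<open>Reconciles the derivatives within \<open>cf_dom\<close> used by \<open>cf_p\<close> and
  \<open>cf_q\<close> with those within \<open>I\<close> used by \<open>aim_lambda\<close> and
  \<open>aim_s\<close>.\<close>

lemma at_within_openin:
  assumes "openin (top_of_set S) T" and "x \<in> T"
  shows "at x within T = at x within S"
proof -
  from assms obtain U where "open U" "T = S \<inter> U" "x \<in> U"
    by (auto simp: openin_open)
  then show ?thesis by (intro at_within_nhd[of x U]) auto
qed

section \<open>Smoothness of the iterates\<close>

lemma smooth_aim:
  assumes nontriv: "\<And>x. x \<in> I \<Longrightarrow> at x within I \<noteq> bot"
    and "smooth_within I lam0" and "smooth_within I s0"
  shows "smooth_within I (aim_lambda I lam0 s0 n) \<and> smooth_within I (aim_s I lam0 s0 n)"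
  using assms
  by (induction n)
     (auto intro!: smooth_within_add smooth_within_mult smooth_within_vector_derivative)

lemma cf_dom_antimono: "m \<le> n \<Longrightarrow> cf_dom I lam0 s0 n \<subseteq> cf_dom I lam0 s0 m"
  by (rule lift_Suc_antimono_le) auto

text \<open>The claims need a joint induction: continuity of \<open>cf_q\<close> makes the next
  domain relatively open, openness carries non-triviality of the filter over from \<open>I\<close>,
  and the next domain is where division by \<open>cf_q\<close> is allowed.\<close>

lemma smooth_cf:
  assumes nontriv: "\<And>x. x \<in> I \<Longrightarrow> at x within I \<noteq> bot"
    and "smooth_within I lam0" and "smooth_within I s0"
  shows "openin (top_of_set I) (cf_dom I lam0 s0 n) \<and>
    smooth_within (cf_dom I lam0 s0 n) (cf_p I lam0 s0 n) \<and>
    smooth_within (cf_dom I lam0 s0 n) (cf_q I lam0 s0 n)"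
proof (induction n)
  case (Suc n)
  let ?D = "cf_dom I lam0 s0 n" and ?p = "cf_p I lam0 s0 n" and ?q = "cf_q I lam0 s0 n"
  let ?D' = "cf_dom I lam0 s0 (Suc n)"
  from Suc have op: "openin (top_of_set I) ?D" and sm: "smooth_within ?D ?p" "smooth_within ?D ?q"
    by auto
  have nt: "at x within ?D \<noteq> bot" if "x \<in> ?D" for x
    using at_within_openin[OF op that] nontriv openin_imp_subset[OF op] that by auto
  have "openin (top_of_set ?D) (?D \<inter> ?q -` (- {0}))"
    using sm(2) by (intro continuous_openin_preimage_gen smooth_within_continuous_on) auto
  moreover have "?D' = ?D \<inter> ?q -` (- {0})" by auto
  ultimately have "openin (top_of_set I) ?D'" using op by (metis openin_trans)
  moreover have "?D' \<subseteq> ?D" by auto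
  then have "smooth_within ?D' ?p" "smooth_within ?D' ?q"
    "smooth_within ?D' (\<lambda>x. vector_derivative ?p (at x within ?D))"
    "smooth_within ?D' (\<lambda>x. vector_derivative ?q (at x within ?D))"
    using sm nt by (blast intro: smooth_within_subset smooth_within_vector_derivative)+
  then have "smooth_within ?D' (cf_p I lam0 s0 (Suc n))" "smooth_within ?D' (cf_q I lam0 s0 (Suc n))"
    unfolding cf_p.simps cf_q.simps
    by (intro smooth_within_add smooth_within_diff smooth_within_mult smooth_within_divide; simp)+
  ultimately show ?case by blast
qed (use assms in simp)

section \<open>Three-term recurrence of the extended sequences\<close>

text \<open>
  The sequences \<open>\<lambda>\<^sub>n\<close>, \<open>s\<^sub>n\<close> with the same index shift by two as \<open>cf_den\<close>, \<open>cf_num\<close>; the additional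
  pairs \<open>(0, 1)\<close> and \<open>(1, 0)\<close> stand for \<open>y\<close> and \<open>y'\<close>.
\<close>

fun ext_lambda :: "real set \<Rightarrow> (real \<Rightarrow> 'a::real_normed_field) \<Rightarrow> (real \<Rightarrow> 'a) \<Rightarrow> nat \<Rightarrow> real \<Rightarrow> 'a" where
  "ext_lambda I lam0 s0 0 = (\<lambda>_. 0)"
| "ext_lambda I lam0 s0 (Suc 0) = (\<lambda>_. 1)"
| "ext_lambda I lam0 s0 (Suc (Suc n)) = aim_lambda I lam0 s0 n"

fun ext_s :: "real set \<Rightarrow> (real \<Rightarrow> 'a::real_normed_field) \<Rightarrow> (real \<Rightarrow> 'a) \<Rightarrow> nat \<Rightarrow> real \<Rightarrow> 'a" where
  "ext_s I lam0 s0 0 = (\<lambda>_. 1)"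
| "ext_s I lam0 s0 (Suc 0) = (\<lambda>_. 0)"
| "ext_s I lam0 s0 (Suc (Suc n)) = aim_s I lam0 s0 n"

text \<open>The iteration sends the pair \<open>(0, 1)\<close> to \<open>(1, 0)\<close> and that to
  \<open>(lam0, s0)\<close>, so it also governs the two added indices.\<close>

lemma ext_lambda_Suc:
  "ext_lambda I lam0 s0 (Suc n) x = vector_derivative (ext_lambda I lam0 s0 n) (at x within I)
     + lam0 x * ext_lambda I lam0 s0 n x + ext_s I lam0 s0 n x"
  and ext_s_Suc:
  "ext_s I lam0 s0 (Suc n) x = vector_derivative (ext_s I lam0 s0 n) (at x within I)
     + s0 x * ext_lambda I lam0 s0 n x"
  if "at x within I \<noteq> bot"
proof -
  have const: "vector_derivative (\<lambda>_. c :: 'a) (at x within I) = 0" for c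
    using that by (intro vector_derivative_within) auto
  show "ext_lambda I lam0 s0 (Suc n) x = vector_derivative (ext_lambda I lam0 s0 n) (at x within I)
     + lam0 x * ext_lambda I lam0 s0 n x + ext_s I lam0 s0 n x"
    by (cases n; cases "n - 1") (simp_all add: const)
  show "ext_s I lam0 s0 (Suc n) x = vector_derivative (ext_s I lam0 s0 n) (at x within I)
     + s0 x * ext_lambda I lam0 s0 n x"
    by (cases n; cases "n - 1") (simp_all add: const)
qed

lemma smooth_ext:
  assumes "\<And>x. x \<in> I \<Longrightarrow> at x within I \<noteq> bot"
    and "smooth_within I lam0" and "smooth_within I s0"
  shows "smooth_within I (ext_lambda I lam0 s0 n) \<and> smooth_within I (ext_s I lam0 s0 n)"
  using smooth_aim[OF assms]
  by (cases n; cases "n - 1") (simp_all add: smooth_within_const)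

text \<open>Induction on \<open>n\<close>: apply the iteration to the relation for \<open>n\<close>,
  then eliminate the oldest term by dividing by \<open>cf_q\<close>. For \<open>n = 0\<close> the
  added pairs make the relation trivial.\<close>

lemma ext_three_term:
  assumes nontriv: "\<And>x. x \<in> I \<Longrightarrow> at x within I \<noteq> bot"
    and sm: "smooth_within I lam0" "smooth_within I s0"
    and "x \<in> cf_dom I lam0 s0 n"
  shows "ext_lambda I lam0 s0 (n + 2) x = cf_p I lam0 s0 n x * ext_lambda I lam0 s0 (n + 1) x
           + cf_q I lam0 s0 n x * ext_lambda I lam0 s0 n x
       \<and> ext_s I lam0 s0 (n + 2) x = cf_p I lam0 s0 n x * ext_s I lam0 s0 (n + 1) x
           + cf_q I lam0 s0 n x * ext_s I lam0 s0 n x"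
  using assms(4)
proof (induction n arbitrary: x)
  case (Suc n)
  let ?D = "cf_dom I lam0 s0 n"
  let ?p = "cf_p I lam0 s0 n" and ?q = "cf_q I lam0 s0 n"
  let ?L = "ext_lambda I lam0 s0" and ?S = "ext_s I lam0 s0"
  let ?d = "\<lambda>f. vector_derivative f (at x within I)"
  from Suc.prems have xD: "x \<in> ?D" and q0: "?q x \<noteq> 0" by auto
  have op: "openin (top_of_set I) ?D"
    using smooth_cf[OF assms(1-3)] by blast
  then have at_eq: "at x within ?D = at x within I" and xI: "x \<in> I"
    using xD at_within_openin[OF op] openin_imp_subset[OF op] by auto
  have dpq: "(?p has_vector_derivative ?d ?p) (at x within I)"
    "(?q has_vector_derivative ?d ?q) (at x within I)"
    using smooth_cf[OF assms(1-3)] smooth_within_has_vector_derivative xD at_eq by metis+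
  have dLS: "(?L k has_vector_derivative ?d (?L k)) (at x within I)"
    "(?S k has_vector_derivative ?d (?S k)) (at x within I)" for k
    using smooth_ext[OF assms(1-3)] smooth_within_has_vector_derivative xI by blast+
  \<comment> \<open>The relation is known only on \<open>?D\<close>, so it is differentiated within
    \<open>?D\<close> and the result is transferred to \<open>I\<close> by
    \<open>at_eq\<close>.\<close>
  have leibniz: "?d (F (n + 2)) =
      ?p x * ?d (F (n + 1)) + ?d ?p * F (n + 1) x + (?q x * ?d (F n) + ?d ?q * F n x)"
    if F: "\<And>k. (F k has_vector_derivative ?d (F k)) (at x within I)"
      and eq: "\<And>t. t \<in> ?D \<Longrightarrow> F (n + 2) t = ?p t * F (n + 1) t + ?q t * F n t"
    for F :: "nat \<Rightarrow> real \<Rightarrow> 'a"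
  proof -
    have "((\<lambda>t. ?p t * F (n + 1) t + ?q t * F n t) has_vector_derivative
        ?p x * ?d (F (n + 1)) + ?d ?p * F (n + 1) x + (?q x * ?d (F n) + ?d ?q * F n x))
        (at x within ?D)"
      unfolding at_eq by (intro has_vector_derivative_add has_vector_derivative_mult dpq F)
    then have "(F (n + 2) has_vector_derivative
        ?p x * ?d (F (n + 1)) + ?d ?p * F (n + 1) x + (?q x * ?d (F n) + ?d ?q * F n x))
        (at x within ?D)"
      by (rule has_vector_derivative_transform[OF xD, rotated]) (simp only: eq)
    then show ?thesis
      unfolding at_eq by (rule vector_derivative_within[OF nontriv[OF xI]])
  qed
  have L: "?d (?L (n + 2)) =
      ?p x * ?d (?L (n + 1)) + ?d ?p * ?L (n + 1) x + (?q x * ?d (?L n) + ?d ?q * ?L n x)"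
    by (rule leibniz) (use dLS Suc.IH in blast)+
  have S: "?d (?S (n + 2)) =
      ?p x * ?d (?S (n + 1)) + ?d ?p * ?S (n + 1) x + (?q x * ?d (?S n) + ?d ?q * ?S n x)"
    by (rule leibniz) (use dLS Suc.IH in blast)+
  \<comment> \<open>Here \<open>u\<close> stands for the values of a sequence, \<open>d\<close> for
    their derivatives and \<open>w\<close> for the derivative-free part of the iteration. That part
    is linear in the pair, so \<open>w\<close> inherits the relation.\<close>
  have step: "d2 + w2 = ?p x * u2 + ?d ?p * u1 + (?q x * u1 + ?d ?q * u0)"
    if "d2 = ?p x * d1 + ?d ?p * u1 + (?q x * d0 + ?d ?q * u0)"
      and "w2 = ?p x * w1 + ?q x * w0" and "u2 = d1 + w1" and "u1 = d0 + w0"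
    for d0 d1 d2 u0 u1 u2 w0 w1 w2
    unfolding that(1,2) by (simp add: that(3,4) algebra_simps)
  note IH = conjunct1[OF Suc.IH[OF xD]] conjunct2[OF Suc.IH[OF xD]]
  have rec: "?L (k + 1) x = ?d (?L k) + (lam0 x * ?L k x + ?S k x)"
    "?S (k + 1) x = ?d (?S k) + s0 x * ?L k x" for k
    using ext_lambda_Suc[OF nontriv[OF xI]] ext_s_Suc[OF nontriv[OF xI]]
    by (simp_all add: add.assoc)
  have rec1: "?L (n + 2) x = ?d (?L (n + 1)) + (lam0 x * ?L (n + 1) x + ?S (n + 1) x)"
    "?S (n + 2) x = ?d (?S (n + 1)) + s0 x * ?L (n + 1) x"
    using rec[of "n + 1"] by (simp_all only: add.assoc one_add_one)
  have rec2: "?L (n + 3) x = ?d (?L (n + 2)) + (lam0 x * ?L (n + 2) x + ?S (n + 2) x)"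
    "?S (n + 3) x = ?d (?S (n + 2)) + s0 x * ?L (n + 2) x"
    using rec[of "n + 2"] by (simp_all add: numeral_eq_Suc)
  \<comment> \<open>Substitute \<open>u0 = (u2 - ?p x * u1) / ?q x\<close>; the resulting
    coefficients are the defining formulas of the next \<open>cf_p\<close> and
    \<open>cf_q\<close>.\<close>
  have elim: "u3 = (?p x + ?d ?q / ?q x) * u2 + (?q x + ?d ?p - ?p x * (?d ?q / ?q x)) * u1"
    if "u2 = ?p x * u1 + ?q x * u0"
      and "u3 = ?p x * u2 + ?d ?p * u1 + (?q x * u1 + ?d ?q * u0)" for u0 u1 u2 u3
    using q0 that by (simp add: field_simps)
  have "?L (n + 3) x = ?p x * ?L (n + 2) x + ?d ?p * ?L (n + 1) x
      + (?q x * ?L (n + 1) x + ?d ?q * ?L n x)"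
    unfolding rec2(1)
    by (rule step[OF L _ rec1(1) rec(1)]) (simp only: IH algebra_simps)
  from elim[OF IH(1) this]
  have "?L (n + 3) x = cf_p I lam0 s0 (Suc n) x * ?L (n + 2) x
      + cf_q I lam0 s0 (Suc n) x * ?L (n + 1) x"
    by (simp add: at_eq)
  moreover
  have "?S (n + 3) x = ?p x * ?S (n + 2) x + ?d ?p * ?S (n + 1) x
      + (?q x * ?S (n + 1) x + ?d ?q * ?S n x)"
    unfolding rec2(2)
    by (rule step[OF S _ rec1(2) rec(2)]) (simp only: IH algebra_simps)
  from elim[OF IH(2) this]
  have "?S (n + 3) x = cf_p I lam0 s0 (Suc n) x * ?S (n + 2) x
      + cf_q I lam0 s0 (Suc n) x * ?S (n + 1) x"
    by (simp add: at_eq)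
  ultimately show ?case by (simp add: numeral_eq_Suc)
qed (simp add: numeral_eq_Suc)

section \<open>Identification with the partial numerators and denominators\<close>

lemma cf_A_cf_B_eq_aim:
  assumes "\<And>x. x \<in> I \<Longrightarrow> at x within I \<noteq> bot"
    and "smooth_within I lam0" and "smooth_within I s0"
    and x: "x \<in> cf_dom I lam0 s0 n"
  shows "cf_A I lam0 s0 n x = aim_s I lam0 s0 n x"
    and "cf_B I lam0 s0 n x = aim_lambda I lam0 s0 n x"
proof -
  \<comment> \<open>The bound keeps \<open>x\<close> in every domain involved: reaching index
    \<open>k + 2\<close> uses the recurrence on \<open>cf_dom\<close> of index
    \<open>k \<le> n\<close>, which contains that of index \<open>n\<close>.\<close>
  have eq: "k \<le> n + 2 \<Longrightarrow>
      cf_den (\<lambda>k. cf_p I lam0 s0 k x) (\<lambda>k. cf_q I lam0 s0 k x) k = ext_lambda I lam0 s0 k x \<and>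
      cf_num (\<lambda>k. cf_p I lam0 s0 k x) (\<lambda>k. cf_q I lam0 s0 k x) k = ext_s I lam0 s0 k x" for k
  proof (induction k rule: induct_nat_012)
    case (ge2 k)
    then have "x \<in> cf_dom I lam0 s0 k"
      using cf_dom_antimono[of k n] x by auto
    from ext_three_term[OF assms(1-3) this] ge2 show ?case by simp
  qed simp_all
  from eq[of "n + 2"]
  show "cf_A I lam0 s0 n x = aim_s I lam0 s0 n x"
    and "cf_B I lam0 s0 n x = aim_lambda I lam0 s0 n x"
    by (simp_all add: cf_A_def cf_B_def)
qed

theorem mainTheorem3:
  fixes I :: "real set" and lam0 s0 :: "real \<Rightarrow> 'a::real_normed_field"
    and n :: nat and x :: real
  assumes "is_interval I" and "interior I \<noteq> {}"
    and "C_infinity_on I lam0" and "C_infinity_on I s0"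
    and "\<And>t. t \<in> I \<Longrightarrow> lam0 t \<noteq> 0"
    and "x \<in> cf_dom I lam0 s0 n"
    and "aim_lambda I lam0 s0 n x \<noteq> 0"
    and "cf_B I lam0 s0 n x \<noteq> 0"
  shows "cf_approximant I lam0 s0 n x = aim_alpha I lam0 s0 n x"
  using cf_A_cf_B_eq_aim[OF at_within_interval_neq_bot[OF assms(1,2)]
      C_infinity_on_imp_smooth_within[OF assms(3)] C_infinity_on_imp_smooth_within[OF assms(4)]
      assms(6)]
  by (simp add: cf_approximant_def aim_alpha_def)

end
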